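(* Let $n,m\ge1$ be integers, let $\mathcal{E}$ be a Hilbert space, and let $\Phi\in\mathrm{Mult}_1(H_m(\mathbb{B}_n,\mathcal{E}))$. Then the following are equivalent: (i) $M_\Phi$ is a pure contraction on $H_m(\mathbb{B}_n,\mathcal{E})$; (ii) $\Phi(0)$ is a pure contraction on $\mathcal{E}$.
   Context: $\mathbb{B}_n$ is the open unit ball of $\mathbb{C}^n$. $H_m(\mathbb{B}_n,\mathcal{E})$ is the $\mathcal{E}$-valued reproducing kernel Hilbert space on $\mathbb{B}_n$ with kernel $K_m(\mathbf{z},\mathbf{w})=(1-\langle\mathbf{z},\mathbf{w}\rangle)^{-m}I_{\mathcal{E}}$ ($m=1$: Drury--Arveson; $m=n$: Hardy; $m=n+1$: Bergman). A multiplier is a function $\Phi:\mathbb{B}_n\to\mathcal{B}(\mathcal{E})$ such that $\Phi f\in H_m(\mathbb{B}_n,\mathcal{E})$ for all $f\in H_m(\mathbb{B}_n,\mathcal{E})$; $M_\Phi$ is the (bounded) operator $f\mapsto\Phi f$, and $\mathrm{Mult}_1$ is the set of multipliers with $\|M_\Phi\|\le1$. A contraction $T$ on a Hilbert space $\mathcal{H}$ is pure if $\|T^{*l}h\|\to0$ as $l\to\infty$ for every $h\in\mathcal{H}$. *)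

theory Defs
  imports "HOL-Analysis.Analysis" "HOL-Library.Function_Algebras"
begin

text \<open>
  Complex Hilbert spaces are given by a subspace \<open>V\<close> of an ambient complex vector space with an
  inner product on \<open>V\<close> (linear in the first argument), so that the coefficient space and the
  function spaces built over it are treated uniformly.
\<close>

definition ip_norm :: "('a \<Rightarrow> 'a \<Rightarrow> complex) \<Rightarrow> 'a \<Rightarrow> real" where
  "ip_norm ip x = sqrt (Re (ip x x))"

locale complex_hilbert_space = vector_space scl
  for scl :: "complex \<Rightarrow> 'a::ab_group_add \<Rightarrow> 'a" +
  fixes V :: "'a set"
    and ip :: "'a \<Rightarrow> 'a \<Rightarrow> complex"
  assumes subspace_carrier: "subspace V"
    and ip_add_left: "\<lbrakk>x \<in> V; y \<in> V; z \<in> V\<rbrakk> \<Longrightarrow> ip (x + y) z = ip x z + ip y z"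
    and ip_scale_left: "\<lbrakk>x \<in> V; y \<in> V\<rbrakk> \<Longrightarrow> ip (scl c x) y = c * ip x y"
    and ip_commute: "\<lbrakk>x \<in> V; y \<in> V\<rbrakk> \<Longrightarrow> ip x y = cnj (ip y x)"
    and ip_nonneg: "x \<in> V \<Longrightarrow> 0 \<le> Re (ip x x)"
    and ip_definite: "\<lbrakk>x \<in> V; ip x x = 0\<rbrakk> \<Longrightarrow> x = 0"
    and complete_carrier:
      "\<lbrakk>\<And>k::nat. X k \<in> V;
        \<forall>e>0. \<exists>N. \<forall>i\<ge>N. \<forall>j\<ge>N. ip_norm ip (X i - X j) < e\<rbrakk>
       \<Longrightarrow> \<exists>x\<in>V. (\<lambda>k. ip_norm ip (X k - x)) \<longlonglongrightarrow> 0"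

definition bounded_operator_on ::
  "(complex \<Rightarrow> 'a::ab_group_add \<Rightarrow> 'a) \<Rightarrow> 'a set \<Rightarrow> ('a \<Rightarrow> 'a \<Rightarrow> complex) \<Rightarrow> ('a \<Rightarrow> 'a) \<Rightarrow> bool" where
  "bounded_operator_on scl V ip T \<longleftrightarrow>
     (\<forall>x\<in>V. T x \<in> V) \<and>
     (\<forall>x\<in>V. \<forall>y\<in>V. T (x + y) = T x + T y) \<and>
     (\<forall>c. \<forall>x\<in>V. T (scl c x) = scl c (T x)) \<and>
     (\<exists>B. \<forall>x\<in>V. ip_norm ip (T x) \<le> B * ip_norm ip x)"

definition contraction_on ::
  "(complex \<Rightarrow> 'a::ab_group_add \<Rightarrow> 'a) \<Rightarrow> 'a set \<Rightarrow> ('a \<Rightarrow> 'a \<Rightarrow> complex) \<Rightarrow> ('a \<Rightarrow> 'a) \<Rightarrow> bool" where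
  "contraction_on scl V ip T \<longleftrightarrow>
     bounded_operator_on scl V ip T \<and> (\<forall>x\<in>V. ip_norm ip (T x) \<le> ip_norm ip x)"

text \<open>
  The Hilbert space adjoint. For a bounded operator on a Hilbert space and \<open>y \<in> V\<close> the described
  vector exists and is unique (Riesz); for \<open>y \<notin> V\<close> the value carries no meaning.
\<close>

definition adjoint_on :: "'a set \<Rightarrow> ('a \<Rightarrow> 'a \<Rightarrow> complex) \<Rightarrow> ('a \<Rightarrow> 'a) \<Rightarrow> 'a \<Rightarrow> 'a" where
  "adjoint_on V ip T y = (THE z. z \<in> V \<and> (\<forall>x\<in>V. ip (T x) y = ip x z))"

definition pure_contraction_on ::
  "(complex \<Rightarrow> 'a::ab_group_add \<Rightarrow> 'a) \<Rightarrow> 'a set \<Rightarrow> ('a \<Rightarrow> 'a \<Rightarrow> complex) \<Rightarrow> ('a \<Rightarrow> 'a) \<Rightarrow> bool" where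
  "pure_contraction_on scl V ip T \<longleftrightarrow>
     contraction_on scl V ip T \<and>
     (\<forall>h\<in>V. (\<lambda>l. ip_norm ip ((adjoint_on V ip T ^^ l) h)) \<longlonglongrightarrow> 0)"

text \<open>
  A function on a set \<open>X\<close> is represented by the total function that agrees with it on \<open>X\<close> and
  vanishes off \<open>X\<close>, so that the pointwise operations on total functions are those of functions
  on \<open>X\<close>.
\<close>

definition fun_on :: "'x set \<Rightarrow> ('x \<Rightarrow> 'e::zero) \<Rightarrow> 'x \<Rightarrow> 'e" where
  "fun_on X f = (\<lambda>x. if x \<in> X then f x else 0)"

definition fun_scale :: "(complex \<Rightarrow> 'e \<Rightarrow> 'e) \<Rightarrow> complex \<Rightarrow> ('x \<Rightarrow> 'e) \<Rightarrow> 'x \<Rightarrow> 'e" where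
  "fun_scale scl c f = (\<lambda>x. scl c (f x))"

text \<open>
  \<open>(H, ipH)\<close> is the \<open>E\<close>-valued reproducing kernel Hilbert space on \<open>X\<close> with operator-valued
  kernel \<open>K\<close>. These conditions determine the set \<open>H\<close>, and \<open>ipH\<close> on \<open>H\<close>, uniquely.
\<close>

locale vector_valued_rkhs =
  E: complex_hilbert_space scl E ipE +
  H: complex_hilbert_space "fun_scale scl" H ipH
  for scl :: "complex \<Rightarrow> 'e::ab_group_add \<Rightarrow> 'e"
    and E :: "'e set"
    and ipE :: "'e \<Rightarrow> 'e \<Rightarrow> complex"
    and X :: "'x set"
    and K :: "'x \<Rightarrow> 'x \<Rightarrow> 'e \<Rightarrow> 'e"
    and H :: "('x \<Rightarrow> 'e) set"
    and ipH :: "('x \<Rightarrow> 'e) \<Rightarrow> ('x \<Rightarrow> 'e) \<Rightarrow> complex" +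
  assumes range_E: "\<lbrakk>f \<in> H; x \<in> X\<rbrakk> \<Longrightarrow> f x \<in> E"
    and zero_off: "\<lbrakk>f \<in> H; x \<notin> X\<rbrakk> \<Longrightarrow> f x = 0"
    and kernel_mem: "\<lbrakk>w \<in> X; \<eta> \<in> E\<rbrakk> \<Longrightarrow> fun_on X (\<lambda>z. K z w \<eta>) \<in> H"
    and reproducing:
      "\<lbrakk>f \<in> H; w \<in> X; \<eta> \<in> E\<rbrakk> \<Longrightarrow> ipH f (fun_on X (\<lambda>z. K z w \<eta>)) = ipE (f w) \<eta>"

abbreviation unit_ball :: "(complex ^ 'n) set" where
  "unit_ball \<equiv> ball 0 1"

definition cinner_vec :: "complex ^ 'n \<Rightarrow> complex ^ 'n \<Rightarrow> complex" where
  "cinner_vec z w = (\<Sum>i\<in>UNIV. z $ i * cnj (w $ i))"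

definition ball_kernel ::
  "(complex \<Rightarrow> 'e \<Rightarrow> 'e) \<Rightarrow> nat \<Rightarrow> complex ^ 'n \<Rightarrow> complex ^ 'n \<Rightarrow> 'e \<Rightarrow> 'e" where
  "ball_kernel scl m z w \<eta> = scl (1 / (1 - cinner_vec z w) ^ m) \<eta>"

text \<open>\<open>(H, ipH)\<close> is $H_m(\mathbb{B}_n, E)$ with \<open>n = CARD('n)\<close>.\<close>

definition is_H_m ::
  "(complex \<Rightarrow> 'e::ab_group_add \<Rightarrow> 'e) \<Rightarrow> 'e set \<Rightarrow> ('e \<Rightarrow> 'e \<Rightarrow> complex) \<Rightarrow> nat \<Rightarrow>
   (complex ^ 'n \<Rightarrow> 'e) set \<Rightarrow> ((complex ^ 'n \<Rightarrow> 'e) \<Rightarrow> (complex ^ 'n \<Rightarrow> 'e) \<Rightarrow> complex) \<Rightarrow> bool" where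
  "is_H_m scl E ipE m H ipH \<longleftrightarrow>
     vector_valued_rkhs scl E ipE unit_ball (ball_kernel scl m) H ipH"

definition mult_op ::
  "(complex ^ 'n \<Rightarrow> 'e::zero \<Rightarrow> 'e) \<Rightarrow> (complex ^ 'n \<Rightarrow> 'e) \<Rightarrow> complex ^ 'n \<Rightarrow> 'e" where
  "mult_op \<Phi> f = fun_on unit_ball (\<lambda>z. \<Phi> z (f z))"

definition Mult ::
  "(complex \<Rightarrow> 'e::ab_group_add \<Rightarrow> 'e) \<Rightarrow> 'e set \<Rightarrow> ('e \<Rightarrow> 'e \<Rightarrow> complex) \<Rightarrow>
   (complex ^ 'n \<Rightarrow> 'e) set \<Rightarrow> (complex ^ 'n \<Rightarrow> 'e \<Rightarrow> 'e) set" where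
  "Mult scl E ipE H =
     {\<Phi>. (\<forall>z\<in>unit_ball. bounded_operator_on scl E ipE (\<Phi> z)) \<and> (\<forall>f\<in>H. mult_op \<Phi> f \<in> H)}"

definition Mult1 ::
  "(complex \<Rightarrow> 'e::ab_group_add \<Rightarrow> 'e) \<Rightarrow> 'e set \<Rightarrow> ('e \<Rightarrow> 'e \<Rightarrow> complex) \<Rightarrow>
   (complex ^ 'n \<Rightarrow> 'e) set \<Rightarrow> ((complex ^ 'n \<Rightarrow> 'e) \<Rightarrow> (complex ^ 'n \<Rightarrow> 'e) \<Rightarrow> complex) \<Rightarrow>
   (complex ^ 'n \<Rightarrow> 'e \<Rightarrow> 'e) set" where
  "Mult1 scl E ipE H ipH =
     {\<Phi> \<in> Mult scl E ipE H. \<forall>f\<in>H. ip_norm ipH (mult_op \<Phi> f) \<le> ip_norm ipH f}"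

end

theory Submission
  imports Defs
begin

text \<open>
  Write \<open>k\<^sub>w \<eta>\<close> for the kernel function at \<open>w\<close> and \<open>R\<close> for the adjoint of \<open>M\<^sub>\<Phi>\<close>, so that
  \<open>R\<^sup>l (k\<^sub>w \<eta>) = k\<^sub>w (\<Phi>(w)*\<^sup>l \<eta>)\<close>. The functions \<open>k\<^sub>0 \<eta>\<close> are the constants and embed \<open>E\<close>
  isometrically, so purity of \<open>M\<^sub>\<Phi>\<close> passes to \<open>\<Phi>(0)\<close>.

  Conversely, for any contraction \<open>R\<close> the orbit \<open>R\<^sup>k x\<close> becomes orthogonal, uniformly, to the
  subspace of those \<open>y\<close> with \<open>R\<^sup>l y\<close> tending to \<open>0\<close>: by Cauchy-Schwarz for the positive semidefinite
  form \<open>\<langle>u, v\<rangle> - \<langle>R\<^sup>l u, R\<^sup>l v\<rangle>\<close>, the quantity \<open>\<langle>R\<^sup>k x, y\<rangle> - \<langle>R\<^sup>l\<^sup>+\<^sup>k x, R\<^sup>l y\<rangle>\<close> is at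
  most \<open>(\<parallel>R\<^sup>k x\<parallel>\<^sup>2 - \<parallel>R\<^sup>l\<^sup>+\<^sup>k x\<parallel>\<^sup>2)\<^sup>1\<^sup>/\<^sup>2 \<parallel>y\<parallel>\<close> in modulus. If \<open>\<Phi>(0)\<close> is pure, this subspace contains all
  constants. Pairing \<open>R\<^sup>k (k\<^sub>w \<eta>)\<close> with the constant \<open>\<zeta> = \<Phi>(w)*\<^sup>k \<eta>\<close> gives \<open>\<parallel>\<zeta>\<parallel>\<^sup>2\<close>, so \<open>\<Phi>(w)*\<^sup>k \<eta>\<close> tends
  to \<open>0\<close>, and density of the span of the kernel functions finishes the proof.
\<close>

section \<open>Positive semidefinite forms and Hilbert space geometry\<close>

text \<open>Definiteness is left out so that Cauchy-Schwarz also covers the defect form of a power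
  of a contraction, which can vanish on nonzero vectors.\<close>

locale semidefinite_form = vector_space scl
  for scl :: "complex \<Rightarrow> 'a::ab_group_add \<Rightarrow> 'a" +
  fixes V :: "'a set"
    and ip :: "'a \<Rightarrow> 'a \<Rightarrow> complex"
  assumes subspace_V: "subspace V"
    and form_add_left: "\<lbrakk>x \<in> V; y \<in> V; z \<in> V\<rbrakk> \<Longrightarrow> ip (x + y) z = ip x z + ip y z"
    and form_scale_left: "\<lbrakk>x \<in> V; y \<in> V\<rbrakk> \<Longrightarrow> ip (scl c x) y = c * ip x y"
    and form_commute: "\<lbrakk>x \<in> V; y \<in> V\<rbrakk> \<Longrightarrow> ip x y = cnj (ip y x)"
    and form_nonneg: "x \<in> V \<Longrightarrow> 0 \<le> Re (ip x x)"
begin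

lemma form_add_right:
  assumes "x \<in> V" "y \<in> V" "z \<in> V"
  shows "ip x (y + z) = ip x y + ip x z"
proof -
  have "ip x (y + z) = cnj (ip (y + z) x)"
    using form_commute[OF assms(1) subspace_add[OF subspace_V assms(2,3)]] .
  also have "\<dots> = ip x y + ip x z"
    using form_add_left[OF assms(2,3,1)] form_commute[OF assms(1,2)] form_commute[OF assms(1,3)]
    by simp
  finally show ?thesis .
qed

lemma form_scale_right:
  assumes "x \<in> V" "y \<in> V"
  shows "ip x (scl c y) = cnj c * ip x y"
  using form_commute[OF assms(1) subspace_scale[OF subspace_V assms(2)]]
    form_scale_left[OF assms(2,1)] form_commute[OF assms] by simp

lemma form_diff_left:
  assumes "x \<in> V" "y \<in> V" "z \<in> V"
  shows "ip (x - y) z = ip x z - ip y z"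
  using form_add_left[OF subspace_diff[OF subspace_V assms(1,2)] assms(2,3)] by simp

lemma form_diff_right:
  assumes "x \<in> V" "y \<in> V" "z \<in> V"
  shows "ip x (y - z) = ip x y - ip x z"
  using form_add_right[OF assms(1) subspace_diff[OF subspace_V assms(2,3)] assms(3)] by simp

text \<open>The coefficient \<open>of_real t * ip x y\<close> makes both cross terms real and equal,
  so only a real quadratic in \<open>t\<close> remains. It serves both Cauchy-Schwarz and the
  nearest-point argument.\<close>

lemma form_self_diff_scale:
  assumes "x \<in> V" "y \<in> V"
  shows "Re (ip (x - scl (of_real t * ip x y) y) (x - scl (of_real t * ip x y) y))
       = Re (ip x x) - 2 * t * (cmod (ip x y))\<^sup>2 + t\<^sup>2 * (cmod (ip x y))\<^sup>2 * Re (ip y y)"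
proof -
  define b where "b = ip x y"
  define u where "u = scl (of_real t * b) y"
  have u: "u \<in> V"
    unfolding u_def using subspace_scale[OF subspace_V assms(2)] .
  have bb: "b * cnj b = of_real ((cmod b)\<^sup>2)"
    by (metis complex_norm_square)
  have yx: "ip y x = cnj b"
    unfolding b_def by (rule form_commute[OF assms(2,1)])
  have xu: "ip x u = of_real t * of_real ((cmod b)\<^sup>2)"
    unfolding u_def form_scale_right[OF assms] b_def[symmetric] bb[symmetric] by simp
  have ux: "ip u x = of_real t * of_real ((cmod b)\<^sup>2)"
    unfolding u_def form_scale_left[OF assms(2,1)] yx bb[symmetric] by simp
  have "ip u u = (of_real t * b) * (cnj (of_real t * b) * ip y y)"
    unfolding u_def using assms subspace_scale[OF subspace_V assms(2)]
    by (simp only: form_scale_left form_scale_right mult.left_commute)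
  also have "\<dots> = of_real (t\<^sup>2) * (b * cnj b) * ip y y"
    by (simp add: power2_eq_square)
  also have "\<dots> = of_real (t\<^sup>2 * (cmod b)\<^sup>2) * ip y y"
    unfolding bb by simp
  finally have uu: "ip u u = of_real (t\<^sup>2 * (cmod b)\<^sup>2) * ip y y" .
  have "ip (x - u) (x - u) = ip x x - ip u x - (ip x u - ip u u)"
    using assms(1) u subspace_diff[OF subspace_V assms(1) u]
    by (simp only: form_diff_left form_diff_right)
  then have "Re (ip (x - u) (x - u)) = Re (ip x x) - Re (ip u x) - Re (ip x u) + Re (ip u u)"
    by simp
  then show ?thesis
    unfolding xu ux uu unfolding u_def b_def Re_complex_of_real
    by (simp del: of_real_power of_real_mult add: of_real_mult[symmetric] Re_complex_of_real)
qed

lemma form_cauchy_schwarz: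
  assumes "x \<in> V" "y \<in> V"
  shows "(cmod (ip x y))\<^sup>2 \<le> Re (ip x x) * Re (ip y y)"
proof -
  define B where "B = (cmod (ip x y))\<^sup>2"
  define c where "c = Re (ip y y)"
  have *: "0 \<le> Re (ip x x) - 2 * t * B + t\<^sup>2 * B * c" for t
    using form_self_diff_scale[OF assms, of t]
      form_nonneg[OF subspace_diff[OF subspace_V assms(1) subspace_scale[OF subspace_V assms(2)]],
        of "of_real t * ip x y"]
    unfolding B_def c_def by simp
  have B0: "0 \<le> B"
    unfolding B_def by simp
  show ?thesis
  proof (cases "c = 0")
    case True
    have "B = 0"
    proof (rule ccontr)
      \<comment> \<open>With \<open>c = 0\<close> the quadratic is affine in \<open>t\<close>; the
        chosen \<open>t\<close> gives it the value -1.\<close>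
      assume "B \<noteq> 0"
      then show False
        using *[of "(Re (ip x x) + 1) / (2 * B)"] True by (simp add: field_simps)
    qed
    then show ?thesis
      using True unfolding B_def c_def by simp
  next
    case False
    then have c: "c > 0"
      using form_nonneg[OF assms(2)] unfolding c_def by simp
    \<comment> \<open>\<open>t = 1 / c\<close> is the minimiser of the quadratic.\<close>
    have "0 \<le> Re (ip x x) - B / c"
      using *[of "1 / c"] c by (simp add: field_simps power2_eq_square)
    then show ?thesis
      using c unfolding B_def[symmetric] c_def[symmetric] by (simp add: field_simps)
  qed
qed

end

sublocale complex_hilbert_space \<subseteq> semidefinite_form
  by unfold_locales
    (auto intro: subspace_carrier ip_add_left ip_scale_left ip_commute ip_nonneg)

section \<open>Norm identities and inequalities\<close>

context complex_hilbert_space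
begin

lemmas carrier_0 = subspace_0[OF subspace_carrier]
  and carrier_add = subspace_add[OF subspace_carrier]
  and carrier_diff = subspace_diff[OF subspace_carrier]
  and carrier_scale = subspace_scale[OF subspace_carrier]

abbreviation nrm :: "'a \<Rightarrow> real" where
  "nrm \<equiv> ip_norm ip"

lemma nrm_sq: "x \<in> V \<Longrightarrow> (nrm x)\<^sup>2 = Re (ip x x)"
  unfolding ip_norm_def by (simp add: ip_nonneg)

lemma nrm_nonneg: "x \<in> V \<Longrightarrow> 0 \<le> nrm x"
  unfolding ip_norm_def by (simp add: ip_nonneg)

lemma ip_self: "x \<in> V \<Longrightarrow> ip x x = of_real ((nrm x)\<^sup>2)"
proof -
  assume x: "x \<in> V"
  have "Im (ip x x) = 0"
    using arg_cong[OF ip_commute[OF x x], of Im] by simp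
  then show ?thesis
    unfolding nrm_sq[OF x] by (simp add: complex_eq_iff)
qed

lemma nrm_0: "nrm 0 = 0"
  using ip_scale_left[OF carrier_0 carrier_0, of 0] unfolding ip_norm_def by simp

lemma nrm_scale: "x \<in> V \<Longrightarrow> nrm (scl c x) = cmod c * nrm x"
proof -
  assume x: "x \<in> V"
  have "ip (scl c x) (scl c x) = (c * cnj c) * ip x x"
    using x carrier_scale[OF x] by (simp add: form_scale_left form_scale_right)
  also have "\<dots> = of_real ((cmod c * nrm x)\<^sup>2)"
    unfolding ip_self[OF x] complex_norm_square[symmetric] by (simp add: power_mult_distrib)
  finally show ?thesis
    unfolding ip_norm_def[of ip "scl c x"] Re_complex_of_real
    by (simp only: Re_complex_of_real real_sqrt_abs) (simp add: nrm_nonneg[OF x])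
qed

lemma cauchy_schwarz:
  assumes "x \<in> V" "y \<in> V"
  shows "cmod (ip x y) \<le> nrm x * nrm y"
proof (rule power2_le_imp_le)
  show "(cmod (ip x y))\<^sup>2 \<le> (nrm x * nrm y)\<^sup>2"
    using form_cauchy_schwarz[OF assms] nrm_sq assms by (simp add: power_mult_distrib)
  show "0 \<le> nrm x * nrm y"
    using nrm_nonneg assms by simp
qed

lemma nrm_sq_add:
  assumes "x \<in> V" "y \<in> V"
  shows "(nrm (x + y))\<^sup>2 = (nrm x)\<^sup>2 + 2 * Re (ip x y) + (nrm y)\<^sup>2"
proof -
  have "Re (ip y x) = Re (ip x y)"
    using ip_commute[OF assms] by simp
  then show ?thesis
    using assms carrier_add[OF assms] by (simp add: nrm_sq form_add_left form_add_right)
qed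

lemma nrm_sq_diff:
  assumes "x \<in> V" "y \<in> V"
  shows "(nrm (x - y))\<^sup>2 = (nrm x)\<^sup>2 - 2 * Re (ip x y) + (nrm y)\<^sup>2"
proof -
  have "Re (ip y x) = Re (ip x y)"
    using ip_commute[OF assms] by simp
  then show ?thesis
    using assms carrier_diff[OF assms] by (simp add: nrm_sq form_diff_left form_diff_right)
qed

lemma nrm_triangle:
  assumes "x \<in> V" "y \<in> V"
  shows "nrm (x + y) \<le> nrm x + nrm y"
proof (rule power2_le_imp_le)
  have "Re (ip x y) \<le> nrm x * nrm y"
    using cauchy_schwarz[OF assms] complex_Re_le_cmod[of "ip x y"] by linarith
  then show "(nrm (x + y))\<^sup>2 \<le> (nrm x + nrm y)\<^sup>2"
    unfolding nrm_sq_add[OF assms] power2_sum by linarith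
  show "0 \<le> nrm x + nrm y"
    using nrm_nonneg assms by simp
qed

lemma nrm_minus_commute:
  assumes "x \<in> V" "y \<in> V"
  shows "nrm (x - y) = nrm (y - x)"
  using nrm_scale[OF carrier_diff[OF assms(2,1)], of "-1"] by (simp add: algebra_simps)

lemma eq_if_ip_eq:
  assumes "x \<in> V" "y \<in> V" "\<And>z. z \<in> V \<Longrightarrow> ip z x = ip z y"
  shows "x = y"
proof -
  have "ip (x - y) (x - y) = 0"
    using assms carrier_diff[OF assms(1,2)] by (simp add: form_diff_right)
  then show ?thesis
    using ip_definite[OF carrier_diff[OF assms(1,2)]] by simp
qed

section \<open>Orthogonal projection and Riesz representation\<close>

definition closed_subspace :: "'a set \<Rightarrow> bool" where
  "closed_subspace S \<longleftrightarrow> subspace S \<and> S \<subseteq> V \<and>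
     (\<forall>X x. (\<forall>k::nat. X k \<in> S) \<and> x \<in> V \<and> (\<lambda>k. nrm (X k - x)) \<longlonglongrightarrow> 0 \<longrightarrow> x \<in> S)"

text \<open>Moving \<open>p\<close> slightly along \<open>s\<close>, with the phase of
  \<open>ip (v - p) s\<close>, would shorten the distance to first order and lengthen it only to
  second order, unless that inner product is zero.\<close>

lemma orthogonal_if_nearest:
  assumes "subspace S" "S \<subseteq> V" "v \<in> V" "p \<in> S" "s \<in> S"
    and nearest: "\<And>t. t \<in> S \<Longrightarrow> (nrm (v - p))\<^sup>2 \<le> (nrm (v - t))\<^sup>2"
  shows "ip (v - p) s = 0"
proof -
  have pV: "p \<in> V" and sV: "s \<in> V"
    using assms by auto
  have uV: "v - p \<in> V"
    using carrier_diff[OF assms(3) pV] .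
  define B where "B = (cmod (ip (v - p) s))\<^sup>2"
  have *: "0 \<le> - 2 * t * B + t\<^sup>2 * B * (nrm s)\<^sup>2" for t
  proof -
    define w where "w = scl (of_real t * ip (v - p) s) s"
    have w: "w \<in> S"
      unfolding w_def using subspace_scale[OF assms(1,5)] .
    have "(nrm (v - p))\<^sup>2 \<le> (nrm (v - p - w))\<^sup>2"
      using nearest[OF subspace_add[OF assms(1,4) w]] by (simp add: algebra_simps)
    also have "\<dots> = (nrm (v - p))\<^sup>2 - 2 * t * B + t\<^sup>2 * B * (nrm s)\<^sup>2"
      using form_self_diff_scale[OF uV sV, of t] carrier_diff[OF uV] w assms(2) uV sV
      unfolding w_def B_def by (auto simp: nrm_sq)
    finally show ?thesis by simp
  qed
  \<comment> \<open>Small enough for the linear term to dominate; the added 1 also covers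
    \<open>s = 0\<close>.\<close>
  define t where "t = 1 / ((nrm s)\<^sup>2 + 1)"
  have n1: "(nrm s)\<^sup>2 + 1 > 0"
    by (simp add: add_nonneg_pos)
  have t: "t > 0" "t * (nrm s)\<^sup>2 \<le> 1"
    unfolding t_def using n1 by (auto simp: field_simps)
  have "0 \<le> t * B * (t * (nrm s)\<^sup>2 - 2)"
    using *[of t] by (simp add: algebra_simps power2_eq_square)
  moreover have "t * (nrm s)\<^sup>2 - 2 < 0"
    using t by simp
  ultimately have "t * B \<le> 0"
    by (metis mult_less_0_iff not_less mult.commute)
  then have "B \<le> 0"
    using t by (simp add: mult_le_0_iff)
  then show ?thesis
    unfolding B_def by simp
qed

text \<open>The parallelogram law in terms of the midpoint, to which the bound by the infimal
  distance applies.\<close>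

lemma parallelogram_midpoint:
  assumes "x \<in> V" "y \<in> V"
  shows "(nrm (x - y))\<^sup>2 = 2 * (nrm x)\<^sup>2 + 2 * (nrm y)\<^sup>2 - 4 * (nrm (scl (1/2) (x + y)))\<^sup>2"
  using assms carrier_add[OF assms]
  by (simp add: nrm_sq_add nrm_sq_diff nrm_scale power_mult_distrib power_divide
      add_divide_distrib del: scale_right_distrib)

text \<open>A minimising sequence for the distance from \<open>v\<close> to \<open>S\<close> is
  Cauchy by the parallelogram law; its limit lies in \<open>S\<close> by closedness and is a nearest
  point, hence orthogonality.\<close>

lemma projection_exists:
  assumes S: "closed_subspace S" and v: "v \<in> V"
  obtains p where "p \<in> S" "\<And>s. s \<in> S \<Longrightarrow> ip (v - p) s = 0"
proof -
  have sub: "subspace S" and SV: "S \<subseteq> V"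
    using S unfolding closed_subspace_def by auto
  define D where "D = (\<lambda>s. (nrm (v - s))\<^sup>2) ` S"
  define d where "d = Inf D"
  have ne: "D \<noteq> {}"
    unfolding D_def using subspace_0[OF sub] by auto
  have bdd: "bdd_below D"
    unfolding D_def by (rule bdd_belowI[of _ 0]) auto
  have d: "d \<le> (nrm (v - s))\<^sup>2" if "s \<in> S" for s
    unfolding d_def by (rule cInf_lower[OF _ bdd]) (use that in \<open>auto simp: D_def\<close>)
  have d0: "0 \<le> d"
    unfolding d_def by (rule cInf_greatest[OF ne]) (auto simp: D_def)
  have "\<exists>s\<in>S. (nrm (v - s))\<^sup>2 < d + 1 / real (Suc k)" for k
    using cInf_lessD[OF ne, of "d + 1 / real (Suc k)"] unfolding d_def D_def by auto
  then obtain X where X: "\<And>k. X k \<in> S"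
    and Xd: "\<And>k. (nrm (v - X k))\<^sup>2 < d + 1 / real (Suc k)"
    by metis
  have XV: "X k \<in> V" for k
    using X SV by auto
  \<comment> \<open>The midpoint of \<open>X i\<close> and \<open>X j\<close> is in
    \<open>S\<close>, so its squared distance from \<open>v\<close> is at least \<open>d\<close>.
    The terms \<open>4 * d\<close> cancel in the parallelogram law.\<close>
  have near: "(nrm (X i - X j))\<^sup>2 < 2 / real (Suc i) + 2 / real (Suc j)" for i j
  proof -
    have V': "v - X i \<in> V" "v - X j \<in> V"
      using carrier_diff v XV by auto
    have mid: "scl (1/2) (v - X j + (v - X i)) = v - scl (1/2) (X i + X j)"
    proof -
      have "v = scl (1/2) v + scl (1/2) v"
        by (simp flip: scale_left_distrib)
      then show ?thesis
        by (simp add: scale_right_diff_distrib scale_right_distrib algebra_simps)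
    qed
    have "scl (1/2) (X i + X j) \<in> S"
      using subspace_scale[OF sub subspace_add[OF sub X X]] .
    then have "d \<le> (nrm (scl (1/2) (v - X j + (v - X i))))\<^sup>2"
      unfolding mid by (rule d)
    moreover have "X i - X j = v - X j - (v - X i)"
      by simp
    ultimately show ?thesis
      using parallelogram_midpoint[OF V'(2,1)] Xd[of i] Xd[of j] by simp
  qed
  have "\<exists>x\<in>V. (\<lambda>k. nrm (X k - x)) \<longlonglongrightarrow> 0"
  proof (rule complete_carrier[OF XV], intro allI impI)
    fix e :: real
    assume e: "e > 0"
    obtain N where N: "inverse (real (Suc N)) < e\<^sup>2 / 4"
      using reals_Archimedean[of "e\<^sup>2 / 4"] e by auto
    have "nrm (X i - X j) < e" if "i \<ge> N" "j \<ge> N" for i j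
    proof -
      have "2 / real (Suc i) \<le> 2 / real (Suc N)" "2 / real (Suc j) \<le> 2 / real (Suc N)"
        using that by (auto intro!: divide_left_mono)
      then have "(nrm (X i - X j))\<^sup>2 < e\<^sup>2"
        using near[of i j] N by (simp add: inverse_eq_divide)
      then show ?thesis
        using e by (simp add: power2_less_imp_less)
    qed
    then show "\<exists>N. \<forall>i\<ge>N. \<forall>j\<ge>N. nrm (X i - X j) < e"
      by blast
  qed
  then obtain p where p: "p \<in> V" and lim: "(\<lambda>k. nrm (X k - p)) \<longlonglongrightarrow> 0"
    by auto
  have pS: "p \<in> S"
    using S X p lim unfolding closed_subspace_def by blast
  \<comment> \<open>Letting \<open>k\<close> tend to infinity shows that \<open>p\<close> attains
    the infimum.\<close>
  have "nrm (v - p) \<le> sqrt (d + 1 / real (Suc k)) + nrm (X k - p)" for k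
  proof -
    have "v - p = (v - X k) + (X k - p)"
      by simp
    then have "nrm (v - p) \<le> nrm (v - X k) + nrm (X k - p)"
      using nrm_triangle[OF carrier_diff[OF v XV] carrier_diff[OF XV p]] by metis
    moreover have "nrm (v - X k) \<le> sqrt (d + 1 / real (Suc k))"
      using Xd[of k] by (intro real_le_rsqrt) simp
    ultimately show ?thesis by simp
  qed
  moreover have "(\<lambda>k. sqrt (d + 1 / real (Suc k)) + nrm (X k - p)) \<longlonglongrightarrow> sqrt (d + 0) + 0"
    by (intro tendsto_intros lim) (rule LIMSEQ_Suc[OF lim_1_over_n])
  ultimately have "nrm (v - p) \<le> sqrt (d + 0) + 0"
    by (intro LIMSEQ_le_const) auto
  then have "(nrm (v - p))\<^sup>2 \<le> d"
    using d0 nrm_nonneg[OF carrier_diff[OF v p]] by (metis add.right_neutral real_sqrt_le_iff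
      power2_eq_square power_mono real_sqrt_pow2)
  then have "(nrm (v - p))\<^sup>2 \<le> (nrm (v - t))\<^sup>2" if "t \<in> S" for t
    using d[OF that] by simp
  then show thesis
    using that[OF pS] orthogonal_if_nearest[OF sub SV v pS] by blast
qed

text \<open>A nonzero \<phi> has a closed kernel, and a vector \<open>u\<close> orthogonal to it
  with \<phi> nonzero at \<open>u\<close>. Subtracting a multiple of \<open>u\<close> from
  \<open>x\<close> lands in the kernel, so \<open>ip x u\<close> determines the value of \<phi> at
  \<open>x\<close>.\<close>

lemma riesz_representation:
  assumes add: "\<And>x y. \<lbrakk>x \<in> V; y \<in> V\<rbrakk> \<Longrightarrow> \<phi> (x + y) = \<phi> x + \<phi> y"
    and scale: "\<And>c x. x \<in> V \<Longrightarrow> \<phi> (scl c x) = c * \<phi> x"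
    and bound: "\<And>x. x \<in> V \<Longrightarrow> cmod (\<phi> x) \<le> B * nrm x"
  obtains z where "z \<in> V" "\<And>x. x \<in> V \<Longrightarrow> \<phi> x = ip x z"
proof (cases "\<forall>x\<in>V. \<phi> x = 0")
  case True
  have "ip x 0 = 0" if "x \<in> V" for x
    using form_scale_right[OF that carrier_0, of 0] by simp
  then show ?thesis
    using that[OF carrier_0] True by simp
next
  case False
  then obtain v where v: "v \<in> V" and \<phi>v: "\<phi> v \<noteq> 0"
    by auto
  have diff: "\<phi> (x - y) = \<phi> x - \<phi> y" if "x \<in> V" "y \<in> V" for x y
    using add[OF carrier_diff[OF that] that(2)] by simp
  define S where "S = {x \<in> V. \<phi> x = 0}"
  have "closed_subspace S"
    unfolding closed_subspace_def
  proof (intro conjI allI impI)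
    have "\<phi> 0 = 0"
      using scale[OF carrier_0, of 0] by simp
    then show "subspace S"
      unfolding S_def
      by (intro subspaceI) (auto simp: add scale carrier_0 carrier_add carrier_scale)
    show "S \<subseteq> V"
      unfolding S_def by auto
    fix X x
    assume *: "(\<forall>k::nat. X k \<in> S) \<and> x \<in> V \<and> (\<lambda>k. nrm (X k - x)) \<longlonglongrightarrow> 0"
    have "cmod (\<phi> x) \<le> B * nrm (X k - x)" for k
    proof -
      have Xk: "X k \<in> V" "\<phi> (X k) = 0"
        using * unfolding S_def by auto
      then show ?thesis
        using bound[OF carrier_diff, of "X k" x] diff[of "X k" x] * by simp
    qed
    moreover have "(\<lambda>k. B * nrm (X k - x)) \<longlonglongrightarrow> B * 0"
      using * by (intro tendsto_intros) auto
    ultimately have "cmod (\<phi> x) \<le> B * 0"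
      by (intro LIMSEQ_le_const) auto
    then show "x \<in> S"
      using * unfolding S_def by simp
  qed
  then obtain p where p: "p \<in> S" and orth: "\<And>s. s \<in> S \<Longrightarrow> ip (v - p) s = 0"
    using projection_exists v by blast
  define u where "u = v - p"
  have pV: "p \<in> V" and \<phi>p: "\<phi> p = 0"
    using p unfolding S_def by auto
  have u: "u \<in> V" and \<phi>u: "\<phi> u \<noteq> 0"
    unfolding u_def using carrier_diff[OF v pV] diff[OF v pV] \<phi>p \<phi>v by auto
  have "u \<noteq> 0"
    using \<phi>u scale[OF carrier_0, of 0] by auto
  then have uu: "ip u u \<noteq> 0"
    using ip_definite[OF u] by auto
  \<comment> \<open>Scaled so that \<open>ip u z = \<phi> u\<close>; the conjugate offsets
    antilinearity in the second argument.\<close>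
  define z where "z = scl (cnj (\<phi> u / ip u u)) u"
  have "\<phi> x = ip x z" if x: "x \<in> V" for x
  proof -
    define y where "y = scl (\<phi> x / \<phi> u) u"
    have y: "y \<in> V"
      unfolding y_def using carrier_scale[OF u] .
    have "\<phi> y = \<phi> x"
      unfolding y_def scale[OF u] using \<phi>u by simp
    then have "x - y \<in> S"
      unfolding S_def using carrier_diff[OF x y] diff[OF x y] by simp
    then have "ip u (x - y) = 0"
      using orth unfolding u_def by simp
    then have "ip (x - y) u = 0"
      using form_commute[OF carrier_diff[OF x y] u] by simp
    then have "ip x u = \<phi> x / \<phi> u * ip u u"
      using form_diff_left[OF x y u] form_scale_left[OF u u] unfolding y_def by simp
    then show ?thesis
      unfolding z_def form_scale_right[OF x u] using uu \<phi>u by simp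
  qed
  moreover have "z \<in> V"
    unfolding z_def using carrier_scale[OF u] .
  ultimately show ?thesis
    using that by blast
qed

section \<open>Adjoints and iterates of contractions\<close>

lemma adjoint_eqI:
  assumes "z \<in> V" "\<And>x. x \<in> V \<Longrightarrow> ip (T x) y = ip x z"
  shows "adjoint_on V ip T y = z"
  unfolding adjoint_on_def
proof (rule the_equality)
  show "z \<in> V \<and> (\<forall>x\<in>V. ip (T x) y = ip x z)"
    using assms by blast
  show "w = z" if "w \<in> V \<and> (\<forall>x\<in>V. ip (T x) y = ip x w)" for w
    by (rule eq_if_ip_eq) (use that assms in auto)
qed

text \<open>Riesz applied to the functional \<open>\<lambda>x. ip (T x) y\<close> supplies the
  vector that the description in \<open>adjoint_on\<close> picks out.\<close>

lemma
  assumes T: "bounded_operator_on scl V ip T" and y: "y \<in> V"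
  shows adjoint_mem: "adjoint_on V ip T y \<in> V"
    and adjoint_ip: "x \<in> V \<Longrightarrow> ip (T x) y = ip x (adjoint_on V ip T y)"
proof -
  obtain B where B: "\<And>x. x \<in> V \<Longrightarrow> nrm (T x) \<le> B * nrm x"
    using T unfolding bounded_operator_on_def by blast
  have TV: "T x \<in> V" if "x \<in> V" for x
    using T that unfolding bounded_operator_on_def by blast
  obtain z where z: "z \<in> V" "\<And>x. x \<in> V \<Longrightarrow> ip (T x) y = ip x z"
  proof (rule riesz_representation[of "\<lambda>x. ip (T x) y" "B * nrm y"])
    show "ip (T (a + b)) y = ip (T a) y + ip (T b) y" if "a \<in> V" "b \<in> V" for a b
      using T that y form_add_left[OF TV TV y] unfolding bounded_operator_on_def by simp
    show "ip (T (scl c a)) y = c * ip (T a) y" if "a \<in> V" for a c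
      using T that form_scale_left[OF TV y] unfolding bounded_operator_on_def by simp
    show "cmod (ip (T a) y) \<le> B * nrm y * nrm a" if "a \<in> V" for a
      using cauchy_schwarz[OF TV[OF that] y] mult_right_mono[OF B[OF that] nrm_nonneg[OF y]]
      by (simp add: mult_ac)
  qed blast
  have "adjoint_on V ip T y = z"
    by (rule adjoint_eqI[where T = T, OF z])
  then show "adjoint_on V ip T y \<in> V" "x \<in> V \<Longrightarrow> ip (T x) y = ip x (adjoint_on V ip T y)"
    using z by auto
qed

lemma contraction_onI:
  assumes "\<And>x. x \<in> V \<Longrightarrow> T x \<in> V"
    and "\<And>x y. \<lbrakk>x \<in> V; y \<in> V\<rbrakk> \<Longrightarrow> T (x + y) = T x + T y"
    and "\<And>c x. x \<in> V \<Longrightarrow> T (scl c x) = scl c (T x)"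
    and "\<And>x. x \<in> V \<Longrightarrow> nrm (T x) \<le> nrm x"
  shows "contraction_on scl V ip T"
  unfolding contraction_on_def bounded_operator_on_def
  using assms by (auto intro!: exI[of _ 1])

lemma contraction_onD:
  assumes "contraction_on scl V ip T"
  shows "x \<in> V \<Longrightarrow> T x \<in> V"
    and "\<lbrakk>x \<in> V; y \<in> V\<rbrakk> \<Longrightarrow> T (x + y) = T x + T y"
    and "x \<in> V \<Longrightarrow> T (scl c x) = scl c (T x)"
    and "x \<in> V \<Longrightarrow> nrm (T x) \<le> nrm x"
  using assms unfolding contraction_on_def bounded_operator_on_def by auto

text \<open>Linearity follows from uniqueness of the adjoint vector. For \<open>y\<close> the
  adjoint value at \<open>x\<close>, \<open>(nrm y)\<^sup>2 = Re (ip (T y) x)\<close> is at most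
  \<open>nrm y * nrm x\<close>.\<close>

lemma contraction_on_adjoint:
  assumes T: "contraction_on scl V ip T"
  shows "contraction_on scl V ip (adjoint_on V ip T)"
proof (rule contraction_onI)
  have b: "bounded_operator_on scl V ip T"
    using T unfolding contraction_on_def by blast
  note mem = adjoint_mem[OF b] and adj = adjoint_ip[OF b] and TV = contraction_onD(1)[OF T]
  show "adjoint_on V ip T x \<in> V" if "x \<in> V" for x
    by (rule mem[OF that])
  show "adjoint_on V ip T (x + y) = adjoint_on V ip T x + adjoint_on V ip T y"
    if "x \<in> V" "y \<in> V" for x y
    by (rule adjoint_eqI) (use that in \<open>auto simp: mem carrier_add form_add_right TV adj\<close>)
  show "adjoint_on V ip T (scl c x) = scl c (adjoint_on V ip T x)" if "x \<in> V" for c x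
    by (rule adjoint_eqI) (use that in \<open>auto simp: mem carrier_scale form_scale_right TV adj\<close>)
  fix x
  assume x: "x \<in> V"
  define y where "y = adjoint_on V ip T x"
  have y: "y \<in> V"
    unfolding y_def by (rule mem[OF x])
  have "(nrm y)\<^sup>2 = Re (ip (T y) x)"
    unfolding nrm_sq[OF y] adj[OF x y] y_def[symmetric] ..
  also have "\<dots> \<le> nrm (T y) * nrm x"
    using cauchy_schwarz[OF TV[OF y] x] complex_Re_le_cmod[of "ip (T y) x"] by linarith
  also have "\<dots> \<le> nrm y * nrm x"
    by (rule mult_right_mono[OF contraction_onD(4)[OF T y] nrm_nonneg[OF x]])
  finally show "nrm (adjoint_on V ip T x) \<le> nrm x"
    using nrm_nonneg[OF y] nrm_nonneg[OF x] unfolding y_def[symmetric] power2_eq_square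
    by (metis mult_le_cancel_left_pos order_le_less)
qed

section \<open>Orbits under powers of a contraction\<close>

lemma contraction_on_funpow:
  assumes R: "contraction_on scl V ip R"
  shows "contraction_on scl V ip (R ^^ l)"
proof (induction l)
  case 0
  show ?case by (rule contraction_onI) auto
next
  case (Suc l)
  show ?case
    by (rule contraction_onI)
      (auto simp: contraction_onD[OF R] contraction_onD[OF Suc]
        intro: order_trans[OF contraction_onD(4)[OF R] contraction_onD(4)[OF Suc]])
qed

text \<open>Reduces purity to a set with dense span. Closedness holds because the powers of
  \<open>R\<close> are contractions, so approximating \<open>x\<close> approximates its whole orbit
  uniformly.\<close>

lemma closed_subspace_iterates_null:
  assumes R: "contraction_on scl V ip R"
  shows "closed_subspace {y \<in> V. (\<lambda>l. nrm ((R ^^ l) y)) \<longlonglongrightarrow> 0}" (is "closed_subspace ?S")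
  unfolding closed_subspace_def
proof (intro conjI allI impI)
  note Rl = contraction_onD[OF contraction_on_funpow[OF R]]
  show "subspace ?S"
  proof (rule subspaceI)
    have "(R ^^ l) 0 = 0" for l
      using Rl(3)[OF carrier_0, of l 0] by simp
    then show "0 \<in> ?S"
      by (simp add: carrier_0 nrm_0)
    show "x + y \<in> ?S" if "x \<in> ?S" "y \<in> ?S" for x y
    proof -
      have xy: "x \<in> V" "y \<in> V"
        and lim: "(\<lambda>l. nrm ((R ^^ l) x) + nrm ((R ^^ l) y)) \<longlonglongrightarrow> 0"
        using that tendsto_add[of "\<lambda>l. nrm ((R ^^ l) x)" 0 _ "\<lambda>l. nrm ((R ^^ l) y)" 0] by auto
      have "(\<lambda>l. nrm ((R ^^ l) (x + y))) \<longlonglongrightarrow> 0"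
        by (rule tendsto_sandwich[OF _ _ tendsto_const lim])
          (use xy in \<open>auto simp: nrm_nonneg Rl carrier_add nrm_triangle\<close>)
      then show ?thesis
        using xy carrier_add by simp
    qed
    show "scl c x \<in> ?S" if "x \<in> ?S" for c x
      using that by (auto simp: Rl nrm_scale carrier_scale intro: tendsto_mult_right_zero)
  qed
  show "?S \<subseteq> V"
    by auto
  fix X x
  assume *: "(\<forall>k::nat. X k \<in> ?S) \<and> x \<in> V \<and> (\<lambda>k. nrm (X k - x)) \<longlonglongrightarrow> 0"
  have x: "x \<in> V" and X: "X k \<in> V" for k
    using * by auto
  have "(\<lambda>l. nrm ((R ^^ l) x)) \<longlonglongrightarrow> 0"
  proof (rule LIMSEQ_I)
    fix e :: real
    assume e: "0 < e"
    \<comment> \<open>One approximant is fixed first, and \<open>N\<close> is then taken from its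
      orbit; the error orbit stays below \<open>e / 2\<close> for every \<open>l\<close>.\<close>
    obtain k where k: "nrm (X k - x) < e / 2"
    proof -
      have "\<forall>\<^sub>F k in sequentially. nrm (X k - x) < e / 2"
        using * e by (intro order_tendstoD(2)[of _ 0]) auto
      then show ?thesis
        using that eventually_happens'[OF sequentially_bot] by blast
    qed
    have "\<forall>\<^sub>F l in sequentially. nrm ((R ^^ l) (X k)) < e / 2"
      using * e by (intro order_tendstoD(2)[of _ 0]) auto
    then obtain N where N: "\<And>l. l \<ge> N \<Longrightarrow> nrm ((R ^^ l) (X k)) < e / 2"
      unfolding eventually_sequentially by blast
    have "norm (nrm ((R ^^ l) x) - 0) < e" if "l \<ge> N" for l
    proof -
      have xX: "x - X k \<in> V"
        using carrier_diff[OF x X] .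
      have "nrm ((R ^^ l) x) = nrm ((R ^^ l) (X k) + (R ^^ l) (x - X k))"
        using Rl(2)[OF X[of k] xX, of l] by simp
      also have "\<dots> \<le> nrm ((R ^^ l) (X k)) + nrm ((R ^^ l) (x - X k))"
        by (rule nrm_triangle[OF Rl(1)[OF X] Rl(1)[OF xX]])
      also have "\<dots> \<le> nrm ((R ^^ l) (X k)) + nrm (X k - x)"
        using Rl(4)[OF xX, of l] nrm_minus_commute[OF x X[of k]] by simp
      finally show ?thesis
        using N[OF that] k nrm_nonneg[OF Rl(1)[OF x, of l]] by simp
    qed
    then show "\<exists>N. \<forall>l\<ge>N. norm (nrm ((R ^^ l) x) - 0) < e"
      by blast
  qed
  then show "x \<in> ?S"
    using x by simp
qed

lemma iterates_defect_bound:
  assumes R: "contraction_on scl V ip R" and x: "x \<in> V" and y: "y \<in> V"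
  shows "(cmod (ip ((R ^^ k) x) y - ip ((R ^^ (l + k)) x) ((R ^^ l) y)))\<^sup>2
       \<le> ((nrm ((R ^^ k) x))\<^sup>2 - (nrm ((R ^^ (l + k)) x))\<^sup>2) * (nrm y)\<^sup>2"
proof -
  note Rl = contraction_onD[OF contraction_on_funpow[OF R]]
  \<comment> \<open>The defect form of \<open>R ^^ l\<close>, positive semidefinite because
    \<open>R ^^ l\<close> is a contraction.\<close>
  define D where "D u v = ip u v - ip ((R ^^ l) u) ((R ^^ l) v)" for u v
  have self: "Re (D u u) = (nrm u)\<^sup>2 - (nrm ((R ^^ l) u))\<^sup>2" if "u \<in> V" for u
    unfolding D_def using that Rl(1) by (simp add: nrm_sq)
  have le: "(nrm ((R ^^ l) u))\<^sup>2 \<le> (nrm u)\<^sup>2" if "u \<in> V" for u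
    using Rl(4)[OF that] nrm_nonneg[OF Rl(1)[OF that]] by (rule power_mono)
  interpret D: semidefinite_form scl V D
  proof unfold_locales
    show "subspace V"
      by (rule subspace_carrier)
    show "D (u + v) w = D u w + D v w" if "u \<in> V" "v \<in> V" "w \<in> V" for u v w
      unfolding D_def using that by (simp add: Rl form_add_left)
    show "D (scl c u) v = c * D u v" if "u \<in> V" "v \<in> V" for c u v
      unfolding D_def using that by (simp add: Rl form_scale_left algebra_simps)
    show "D u v = cnj (D v u)" if "u \<in> V" "v \<in> V" for u v
      unfolding D_def using form_commute[OF that] form_commute[OF Rl(1)[OF that(1)] Rl(1)[OF that(2)]]
      by simp
    show "0 \<le> Re (D u u)" if "u \<in> V" for u
      using self[OF that] le[OF that] by simp
  qed
  have "(cmod (D ((R ^^ k) x) y))\<^sup>2 \<le> Re (D ((R ^^ k) x) ((R ^^ k) x)) * Re (D y y)"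
    by (rule D.form_cauchy_schwarz[OF Rl(1)[OF x] y])
  \<comment> \<open>In the second factor the subtracted square
    \<open>(nrm ((R ^^ l) y))\<^sup>2\<close> is dropped.\<close>
  also have "\<dots> \<le> ((nrm ((R ^^ k) x))\<^sup>2 - (nrm ((R ^^ l) ((R ^^ k) x)))\<^sup>2) * (nrm y)\<^sup>2"
    unfolding self[OF Rl(1)[OF x]] self[OF y]
    using le[OF Rl(1)[OF x]] by (intro mult_left_mono) auto
  finally show ?thesis
    unfolding D_def by (simp add: funpow_add)
qed

text \<open>The point is that \<epsilon> depends on \<open>x\<close> but not on \<open>y\<close>, so
  \<open>y\<close> may later vary with \<open>k\<close>. The squared orbit norms decrease to a limit
  \<open>L\<close>, and \<open>\<epsilon> k\<close> is the square root of the excess over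
  \<open>L\<close>.\<close>

lemma iterates_asymptotically_orthogonal:
  assumes R: "contraction_on scl V ip R" and x: "x \<in> V"
  obtains \<epsilon> :: "nat \<Rightarrow> real" where "\<epsilon> \<longlonglongrightarrow> 0"
    and "\<And>k y. \<lbrakk>y \<in> V; (\<lambda>l. nrm ((R ^^ l) y)) \<longlonglongrightarrow> 0\<rbrakk> \<Longrightarrow> cmod (ip ((R ^^ k) x) y) \<le> \<epsilon> k * nrm y"
proof -
  note Rl = contraction_onD[OF contraction_on_funpow[OF R]]
  define e where "e k = (nrm ((R ^^ k) x))\<^sup>2" for k
  have "decseq e"
    unfolding e_def
    by (rule decseq_SucI, rule power_mono)
      (use Rl(1)[OF x] nrm_nonneg contraction_onD[OF R] in auto)
  moreover have "0 \<le> e k" for k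
    unfolding e_def by simp
  ultimately obtain L where L: "e \<longlonglongrightarrow> L" "\<And>k. L \<le> e k"
    using decseq_convergent by metis
  define \<epsilon> where "\<epsilon> k = sqrt (e k - L)" for k
  have "\<epsilon> \<longlonglongrightarrow> 0"
    unfolding \<epsilon>_def using tendsto_real_sqrt[OF tendsto_diff[OF L(1) tendsto_const[of L]]] by simp
  moreover have "cmod (ip ((R ^^ k) x) y) \<le> \<epsilon> k * nrm y"
    if y: "y \<in> V" and null: "(\<lambda>l. nrm ((R ^^ l) y)) \<longlonglongrightarrow> 0" for k y
  proof -
    \<comment> \<open>Bounding \<open>e (l + k)\<close> below by \<open>L\<close> frees the first
      summand of \<open>l\<close>; the second vanishes as \<open>l\<close> grows.\<close>
    have "cmod (ip ((R ^^ k) x) y) \<le> \<epsilon> k * nrm y + nrm x * nrm ((R ^^ l) y)" for l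
    proof -
      define a b where "a = ip ((R ^^ k) x) y" and "b = ip ((R ^^ (l + k)) x) ((R ^^ l) y)"
      have "cmod b \<le> nrm ((R ^^ (l + k)) x) * nrm ((R ^^ l) y)"
        unfolding b_def by (rule cauchy_schwarz[OF Rl(1)[OF x] Rl(1)[OF y]])
      also have "\<dots> \<le> nrm x * nrm ((R ^^ l) y)"
        by (rule mult_right_mono[OF Rl(4)[OF x] nrm_nonneg[OF Rl(1)[OF y]]])
      finally have b: "cmod b \<le> nrm x * nrm ((R ^^ l) y)" .
      have "(cmod (a - b))\<^sup>2 \<le> (e k - e (l + k)) * (nrm y)\<^sup>2"
        unfolding a_def b_def e_def by (rule iterates_defect_bound[OF R x y])
      also have "\<dots> \<le> (e k - L) * (nrm y)\<^sup>2"
        using L(2) by (intro mult_right_mono) auto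
      also have "\<dots> = (\<epsilon> k * nrm y)\<^sup>2"
        unfolding \<epsilon>_def using L(2)[of k] by (simp add: power_mult_distrib)
      finally have "cmod (a - b) \<le> \<epsilon> k * nrm y"
        by (rule power2_le_imp_le) (use L(2)[of k] nrm_nonneg[OF y] in \<open>simp add: \<epsilon>_def\<close>)
      moreover have "cmod a \<le> cmod (a - b) + cmod b"
        using norm_triangle_ineq[of "a - b" b] by simp
      ultimately show ?thesis
        using b unfolding a_def by linarith
    qed
    moreover have "(\<lambda>l. \<epsilon> k * nrm y + nrm x * nrm ((R ^^ l) y)) \<longlonglongrightarrow> \<epsilon> k * nrm y + nrm x * 0"
      by (intro tendsto_intros null)
    ultimately have "cmod (ip ((R ^^ k) x) y) \<le> \<epsilon> k * nrm y + nrm x * 0"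
      by (intro LIMSEQ_le_const) auto
    then show ?thesis by simp
  qed
  ultimately show thesis
    using that by blast
qed

end

section \<open>Multipliers of reproducing kernel Hilbert spaces\<close>

context vector_valued_rkhs
begin

text \<open>Density of the span of the kernel functions: the component of \<open>f\<close>
  orthogonal to \<open>S\<close> is orthogonal to every kernel function, so by the reproducing
  property it is zero at each point of \<open>X\<close>.\<close>

lemma eq_carrier_if_kernels_mem:
  assumes S: "H.closed_subspace S"
    and ker: "\<And>w \<eta>. \<lbrakk>w \<in> X; \<eta> \<in> E\<rbrakk> \<Longrightarrow> fun_on X (\<lambda>z. K z w \<eta>) \<in> S"
    and f: "f \<in> H"
  shows "f \<in> S"
proof -
  obtain p where p: "p \<in> S" and orth: "\<And>s. s \<in> S \<Longrightarrow> ipH (f - p) s = 0"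
    using H.projection_exists[OF S f] by blast
  have g: "f - p \<in> H"
    using S p f H.carrier_diff unfolding H.closed_subspace_def by blast
  have "(f - p) w = 0" for w
  proof (cases "w \<in> X")
    case True
    \<comment> \<open>The kernel function is taken with coefficient \<open>(f - p) w\<close>
      itself.\<close>
    have "ipE ((f - p) w) ((f - p) w) = 0"
      using reproducing[OF g True range_E[OF g True]] orth[OF ker[OF True range_E[OF g True]]] by simp
    then show ?thesis
      using E.ip_definite[OF range_E[OF g True]] by blast
  next
    case False
    then show ?thesis
      using zero_off[OF g] by blast
  qed
  then have "f - p = 0"
    by (intro ext) simp
  then show ?thesis
    using p by simp
qed

text \<open>Pairing with a kernel function at \<open>w\<close> evaluates at \<open>w\<close>, where
  the multiplier acts as \<open>\<Phi> w\<close>, which then moves across the inner product of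
  \<open>E\<close>. Membership in \<open>E\<close> is tracked because \<open>adjoint_on\<close> has
  meaning only there.\<close>

lemma adjoint_kernel:
  assumes \<Phi>: "bounded_operator_on scl E ipE (\<Phi> w)" and w: "w \<in> X" and \<eta>: "\<eta> \<in> E"
    and mem: "\<And>f. f \<in> H \<Longrightarrow> fun_on X (\<lambda>z. \<Phi> z (f z)) \<in> H"
  shows "(adjoint_on H ipH (\<lambda>f. fun_on X (\<lambda>z. \<Phi> z (f z))) ^^ l) (fun_on X (\<lambda>z. K z w \<eta>))
       = fun_on X (\<lambda>z. K z w ((adjoint_on E ipE (\<Phi> w) ^^ l) \<eta>))"
    and "(adjoint_on E ipE (\<Phi> w) ^^ l) \<eta> \<in> E"
proof -
  have step: "adjoint_on H ipH (\<lambda>f. fun_on X (\<lambda>z. \<Phi> z (f z))) (fun_on X (\<lambda>z. K z w \<zeta>))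
       = fun_on X (\<lambda>z. K z w (adjoint_on E ipE (\<Phi> w) \<zeta>))" if \<zeta>: "\<zeta> \<in> E" for \<zeta>
  proof (rule H.adjoint_eqI)
    have a: "adjoint_on E ipE (\<Phi> w) \<zeta> \<in> E"
      by (rule E.adjoint_mem[OF \<Phi> \<zeta>])
    then show "fun_on X (\<lambda>z. K z w (adjoint_on E ipE (\<Phi> w) \<zeta>)) \<in> H"
      by (rule kernel_mem[OF w])
    fix f
    assume f: "f \<in> H"
    have "ipH (fun_on X (\<lambda>z. \<Phi> z (f z))) (fun_on X (\<lambda>z. K z w \<zeta>)) = ipE (\<Phi> w (f w)) \<zeta>"
      unfolding reproducing[OF mem[OF f] w \<zeta>] using w by (simp add: fun_on_def)
    also have "\<dots> = ipE (f w) (adjoint_on E ipE (\<Phi> w) \<zeta>)"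
      by (rule E.adjoint_ip[OF \<Phi> \<zeta> range_E[OF f w]])
    also have "\<dots> = ipH f (fun_on X (\<lambda>z. K z w (adjoint_on E ipE (\<Phi> w) \<zeta>)))"
      by (rule reproducing[OF f w a, symmetric])
    finally show "ipH (fun_on X (\<lambda>z. \<Phi> z (f z))) (fun_on X (\<lambda>z. K z w \<zeta>))
        = ipH f (fun_on X (\<lambda>z. K z w (adjoint_on E ipE (\<Phi> w) \<zeta>)))" .
  qed
  show iter_mem: "(adjoint_on E ipE (\<Phi> w) ^^ l) \<eta> \<in> E" for l
    by (induction l) (auto simp: \<eta> intro: E.adjoint_mem[OF \<Phi>])
  show "(adjoint_on H ipH (\<lambda>f. fun_on X (\<lambda>z. \<Phi> z (f z))) ^^ l) (fun_on X (\<lambda>z. K z w \<eta>))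
       = fun_on X (\<lambda>z. K z w ((adjoint_on E ipE (\<Phi> w) ^^ l) \<eta>))"
    by (induction l) (auto simp: step iter_mem)
qed

lemma mult_contraction:
  assumes \<Phi>: "\<And>z. z \<in> X \<Longrightarrow> bounded_operator_on scl E ipE (\<Phi> z)"
    and mem: "\<And>f. f \<in> H \<Longrightarrow> fun_on X (\<lambda>z. \<Phi> z (f z)) \<in> H"
    and le: "\<And>f. f \<in> H \<Longrightarrow> ip_norm ipH (fun_on X (\<lambda>z. \<Phi> z (f z))) \<le> ip_norm ipH f"
  shows "contraction_on (fun_scale scl) H ipH (\<lambda>f. fun_on X (\<lambda>z. \<Phi> z (f z)))"
proof (rule H.contraction_onI)
  show "fun_on X (\<lambda>z. \<Phi> z ((f + g) z)) = fun_on X (\<lambda>z. \<Phi> z (f z)) + fun_on X (\<lambda>z. \<Phi> z (g z))"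
    if "f \<in> H" "g \<in> H" for f g
    using that range_E \<Phi> unfolding bounded_operator_on_def
    by (intro ext) (simp add: fun_on_def)
  show "fun_on X (\<lambda>z. \<Phi> z (fun_scale scl c f z)) = fun_scale scl c (fun_on X (\<lambda>z. \<Phi> z (f z)))"
    if "f \<in> H" for c f
    using that range_E \<Phi> unfolding bounded_operator_on_def
    by (intro ext) (simp add: fun_on_def fun_scale_def)
qed (use mem le in auto)

end

section \<open>Kernel functions of the spaces on the ball\<close>

locale H_m_space =
  vector_valued_rkhs scl E ipE "unit_ball :: (complex ^ 'n) set" "ball_kernel scl m" H ipH
  for scl :: "complex \<Rightarrow> 'e::ab_group_add \<Rightarrow> 'e"
    and E :: "'e set"
    and ipE :: "'e \<Rightarrow> 'e \<Rightarrow> complex"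
    and m :: nat
    and H :: "(complex ^ 'n \<Rightarrow> 'e) set"
    and ipH :: "(complex ^ 'n \<Rightarrow> 'e) \<Rightarrow> (complex ^ 'n \<Rightarrow> 'e) \<Rightarrow> complex"
begin

definition ker :: "complex ^ 'n \<Rightarrow> 'e \<Rightarrow> complex ^ 'n \<Rightarrow> 'e" where
  "ker w \<eta> = fun_on unit_ball (\<lambda>z. ball_kernel scl m z w \<eta>)"

lemma ker_mem: "\<lbrakk>w \<in> unit_ball; \<eta> \<in> E\<rbrakk> \<Longrightarrow> ker w \<eta> \<in> H"
  unfolding ker_def by (rule kernel_mem)

lemma ip_ker: "\<lbrakk>f \<in> H; w \<in> unit_ball; \<eta> \<in> E\<rbrakk> \<Longrightarrow> ipH f (ker w \<eta>) = ipE (f w) \<eta>"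
  unfolding ker_def by (rule reproducing)

text \<open>The scalar kernel is 1 at the origin for every \<open>w\<close>. Hence pairing
  \<open>ker w \<zeta>\<close> with \<open>ker 0 \<zeta>\<close> gives the squared norm of
  \<zeta>.\<close>

lemma ker_at_0: "ker w \<eta> 0 = \<eta>"
  by (simp add: ker_def fun_on_def ball_kernel_def cinner_vec_def)

text \<open>The factor depends on \<open>w\<close> alone, so for fixed \<open>w\<close> null
  sequences in \<open>E\<close> give null sequences of kernel functions.\<close>

lemma norm_ker:
  assumes w: "w \<in> unit_ball" and \<eta>: "\<eta> \<in> E"
  shows "H.nrm (ker w \<eta>) = sqrt (Re (1 / (1 - cinner_vec w w) ^ m)) * E.nrm \<eta>"
proof -
  have "ipH (ker w \<eta>) (ker w \<eta>) = (1 / (1 - cinner_vec w w) ^ m) * ipE \<eta> \<eta>"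
    unfolding ip_ker[OF ker_mem[OF assms] assms]
    using w E.form_scale_left[OF \<eta> \<eta>] by (simp add: ker_def fun_on_def ball_kernel_def)
  also have "\<dots> = (1 / (1 - cinner_vec w w) ^ m) * of_real ((E.nrm \<eta>)\<^sup>2)"
    unfolding E.ip_self[OF \<eta>] ..
  finally have "Re (ipH (ker w \<eta>) (ker w \<eta>)) = Re (1 / (1 - cinner_vec w w) ^ m) * (E.nrm \<eta>)\<^sup>2"
    by (simp only: times_complex.sel Re_complex_of_real Im_complex_of_real mult_zero_right diff_zero)
  then show ?thesis
    unfolding ip_norm_def[of ipH] by (simp add: real_sqrt_mult E.nrm_nonneg[OF \<eta>])
qed

lemma norm_ker_0: "\<eta> \<in> E \<Longrightarrow> H.nrm (ker 0 \<eta>) = E.nrm \<eta>"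
  by (subst norm_ker) (simp_all add: cinner_vec_def)

text \<open>Evaluation at 0 is the adjoint of the isometric embedding \<open>ker 0\<close> of
  \<open>E\<close>.\<close>

lemma norm_eval_0:
  assumes f: "f \<in> H"
  shows "E.nrm (f 0) \<le> H.nrm f"
proof -
  have E: "f 0 \<in> E"
    using range_E[OF f] by simp
  have "(E.nrm (f 0))\<^sup>2 = Re (ipH f (ker 0 (f 0)))"
    using E f by (simp add: E.nrm_sq ip_ker)
  also have "\<dots> \<le> H.nrm f * E.nrm (f 0)"
    using H.cauchy_schwarz[OF f ker_mem[OF _ E], of 0] norm_ker_0[OF E]
      complex_Re_le_cmod[of "ipH f (ker 0 (f 0))"] by simp
  finally show ?thesis
    using E.nrm_nonneg[OF E] H.nrm_nonneg[OF f] unfolding power2_eq_square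
    by (metis mult_le_cancel_right_pos order_le_less)
qed

section \<open>Contractive multipliers\<close>

context
  fixes \<Phi> :: "complex ^ 'n \<Rightarrow> 'e \<Rightarrow> 'e"
  assumes \<Phi>: "\<Phi> \<in> Mult1 scl E ipE H ipH"
begin

lemma bounded_value: "w \<in> unit_ball \<Longrightarrow> bounded_operator_on scl E ipE (\<Phi> w)"
  using \<Phi> unfolding Mult1_def Mult_def by blast

lemma mult_mem: "f \<in> H \<Longrightarrow> mult_op \<Phi> f \<in> H"
  using \<Phi> unfolding Mult1_def Mult_def by blast

lemma mult_norm_le: "f \<in> H \<Longrightarrow> H.nrm (mult_op \<Phi> f) \<le> H.nrm f"
  using \<Phi> unfolding Mult1_def by blast

lemma mult_op_contraction: "contraction_on (fun_scale scl) H ipH (mult_op \<Phi>)"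
  unfolding mult_op_def[abs_def]
  by (rule mult_contraction) (auto simp: bounded_value mult_mem[unfolded mult_op_def]
    mult_norm_le[unfolded mult_op_def])

text \<open>\<open>\<Phi> 0\<close> is the composite of the embedding as constants, the multiplier
  and evaluation at 0, none of which increases norms.\<close>

lemma value_0_contraction: "contraction_on scl E ipE (\<Phi> 0)"
  unfolding contraction_on_def
proof (intro conjI ballI)
  show "bounded_operator_on scl E ipE (\<Phi> 0)"
    by (rule bounded_value) simp
  fix \<eta>
  assume \<eta>: "\<eta> \<in> E"
  have k: "ker 0 \<eta> \<in> H"
    by (rule ker_mem) (simp_all add: \<eta>)
  have "\<Phi> 0 \<eta> = mult_op \<Phi> (ker 0 \<eta>) 0"
    by (simp add: mult_op_def fun_on_def ker_at_0)
  then show "E.nrm (\<Phi> 0 \<eta>) \<le> E.nrm \<eta>"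
    using norm_eval_0[OF mult_mem[OF k]] mult_norm_le[OF k] norm_ker_0[OF \<eta>] by simp
qed

lemma
  assumes "w \<in> unit_ball" "\<eta> \<in> E"
  shows adjoint_iterate_ker:
      "(adjoint_on H ipH (mult_op \<Phi>) ^^ l) (ker w \<eta>) = ker w ((adjoint_on E ipE (\<Phi> w) ^^ l) \<eta>)"
    and adjoint_iterate_mem: "(adjoint_on E ipE (\<Phi> w) ^^ l) \<eta> \<in> E"
  using adjoint_kernel[where \<Phi> = \<Phi>, OF bounded_value[OF assms(1)] assms
      mult_mem[unfolded mult_op_def], of l]
  unfolding ker_def mult_op_def[abs_def] by auto

text \<open>Null orbits at the origin spread to every \<open>w\<close>: the orbit of
  \<open>ker w \<eta>\<close> is tested against a constant that changes with \<open>k\<close>, which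
  the uniform bound permits.\<close>

lemma adjoint_iterates_value_null:
  assumes null: "\<And>\<eta>. \<eta> \<in> E \<Longrightarrow> (\<lambda>l. E.nrm ((adjoint_on E ipE (\<Phi> 0) ^^ l) \<eta>)) \<longlonglongrightarrow> 0"
    and w: "w \<in> unit_ball" and \<eta>: "\<eta> \<in> E"
  shows "(\<lambda>l. E.nrm ((adjoint_on E ipE (\<Phi> w) ^^ l) \<eta>)) \<longlonglongrightarrow> 0"
proof -
  define R where "R = adjoint_on H ipH (mult_op \<Phi>)"
  define \<zeta> where "\<zeta> k = (adjoint_on E ipE (\<Phi> w) ^^ k) \<eta>" for k
  have \<zeta>: "\<zeta> k \<in> E" for k
    unfolding \<zeta>_def by (rule adjoint_iterate_mem[OF w \<eta>])
  have R: "contraction_on (fun_scale scl) H ipH R"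
    unfolding R_def by (rule H.contraction_on_adjoint[OF mult_op_contraction])
  obtain \<epsilon> where \<epsilon>: "\<epsilon> \<longlonglongrightarrow> 0" and bound:
    "\<And>k y. \<lbrakk>y \<in> H; (\<lambda>l. H.nrm ((R ^^ l) y)) \<longlonglongrightarrow> 0\<rbrakk>
       \<Longrightarrow> cmod (ipH ((R ^^ k) (ker w \<eta>)) y) \<le> \<epsilon> k * H.nrm y"
    using H.iterates_asymptotically_orthogonal[OF R ker_mem[OF w \<eta>]] by blast
  \<comment> \<open>The absolute value keeps the bound valid when \<open>\<zeta> k = 0\<close>,
    where the norm cannot be cancelled and the sign of \<open>\<epsilon> k\<close> is
    unknown.\<close>
  have le: "E.nrm (\<zeta> k) \<le> \<bar>\<epsilon> k\<bar>" for k
  proof -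
    have y: "ker 0 (\<zeta> k) \<in> H"
      by (rule ker_mem) (simp_all add: \<zeta>)
    have "(\<lambda>l. H.nrm ((R ^^ l) (ker 0 (\<zeta> k)))) \<longlonglongrightarrow> 0"
      unfolding R_def using null[OF \<zeta>[of k]]
      by (simp add: adjoint_iterate_ker \<zeta> norm_ker_0 adjoint_iterate_mem)
    then have "cmod (ipH ((R ^^ k) (ker w \<eta>)) (ker 0 (\<zeta> k))) \<le> \<epsilon> k * H.nrm (ker 0 (\<zeta> k))"
      by (rule bound[OF y])
    moreover have "ipH ((R ^^ k) (ker w \<eta>)) (ker 0 (\<zeta> k)) = of_real ((E.nrm (\<zeta> k))\<^sup>2)"
      unfolding R_def adjoint_iterate_ker[OF w \<eta>] \<zeta>_def[symmetric]
      by (simp add: ip_ker ker_mem w \<zeta> ker_at_0 E.ip_self del: mem_ball mem_ball_0)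
    ultimately have "(E.nrm (\<zeta> k))\<^sup>2 \<le> \<epsilon> k * E.nrm (\<zeta> k)"
      by (simp add: norm_ker_0 \<zeta> norm_power)
    then show ?thesis
      using E.nrm_nonneg[OF \<zeta>[of k]] unfolding power2_eq_square
      by (metis abs_ge_self abs_ge_zero mult_le_cancel_right_pos order_le_less order_trans)
  qed
  have "(\<lambda>k. \<bar>\<epsilon> k\<bar>) \<longlonglongrightarrow> 0"
    using \<epsilon> by (rule tendsto_rabs_zero)
  then have "(\<lambda>k. E.nrm (\<zeta> k)) \<longlonglongrightarrow> 0"
    by (rule tendsto_sandwich[OF _ _ tendsto_const, rotated 2])
      (auto simp: le E.nrm_nonneg[OF \<zeta>])
  then show ?thesis
    unfolding \<zeta>_def .
qed

lemma pure_iff_pure_at_0: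
  "pure_contraction_on (fun_scale scl) H ipH (mult_op \<Phi>) \<longleftrightarrow> pure_contraction_on scl E ipE (\<Phi> 0)"
proof
  assume pure: "pure_contraction_on (fun_scale scl) H ipH (mult_op \<Phi>)"
  have "(\<lambda>l. E.nrm ((adjoint_on E ipE (\<Phi> 0) ^^ l) \<eta>)) \<longlonglongrightarrow> 0" if \<eta>: "\<eta> \<in> E" for \<eta>
  proof -
    \<comment> \<open>The isometry \<open>ker 0\<close> intertwines the adjoint of
      \<open>\<Phi> 0\<close> with that of \<open>mult_op \<Phi>\<close>, so the two orbits have
      equal norms.\<close>
    have "(\<lambda>l. H.nrm ((adjoint_on H ipH (mult_op \<Phi>) ^^ l) (ker 0 \<eta>))) \<longlonglongrightarrow> 0"
      using pure ker_mem[OF _ \<eta>, of 0] unfolding pure_contraction_on_def by simp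
    then show ?thesis
      by (simp add: adjoint_iterate_ker \<eta> norm_ker_0 adjoint_iterate_mem)
  qed
  then show "pure_contraction_on scl E ipE (\<Phi> 0)"
    unfolding pure_contraction_on_def using value_0_contraction by blast
next
  assume pure: "pure_contraction_on scl E ipE (\<Phi> 0)"
  define R where "R = adjoint_on H ipH (mult_op \<Phi>)"
  define S where "S = {f \<in> H. (\<lambda>l. H.nrm ((R ^^ l) f)) \<longlonglongrightarrow> 0}"
  have "H.closed_subspace S"
    unfolding S_def R_def
    by (rule H.closed_subspace_iterates_null[OF H.contraction_on_adjoint[OF mult_op_contraction]])
  moreover have "ker w \<eta> \<in> S" if w: "w \<in> unit_ball" and \<eta>: "\<eta> \<in> E" for w \<eta>
  proof -
    have "(\<lambda>l. E.nrm ((adjoint_on E ipE (\<Phi> w) ^^ l) \<eta>)) \<longlonglongrightarrow> 0"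
      by (rule adjoint_iterates_value_null[OF _ w \<eta>]) (use pure in \<open>auto simp: pure_contraction_on_def\<close>)
    then show ?thesis
      unfolding S_def R_def
      by (simp add: ker_mem adjoint_iterate_ker norm_ker adjoint_iterate_mem w \<eta> tendsto_mult_right_zero
        del: mem_ball mem_ball_0)
  qed
  \<comment> \<open>A closed subspace containing all kernel functions is the whole space.\<close>
  ultimately have "f \<in> S" if "f \<in> H" for f
    using eq_carrier_if_kernels_mem[OF _ _ that] unfolding ker_def by blast
  then show "pure_contraction_on (fun_scale scl) H ipH (mult_op \<Phi>)"
    unfolding pure_contraction_on_def S_def R_def using mult_op_contraction by blast
qed

end

end

theorem theorem4p4:
  fixes scl :: "complex \<Rightarrow> 'e::ab_group_add \<Rightarrow> 'e"
    and E :: "'e set"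
    and ipE :: "'e \<Rightarrow> 'e \<Rightarrow> complex"
    and m :: nat
    and H :: "(complex ^ 'n \<Rightarrow> 'e) set"
    and ipH :: "(complex ^ 'n \<Rightarrow> 'e) \<Rightarrow> (complex ^ 'n \<Rightarrow> 'e) \<Rightarrow> complex"
    and \<Phi> :: "complex ^ 'n \<Rightarrow> 'e \<Rightarrow> 'e"
  assumes "m \<ge> 1"
    and "complex_hilbert_space scl E ipE"
    and "is_H_m scl E ipE m H ipH"
    and "\<Phi> \<in> Mult1 scl E ipE H ipH"
  shows "pure_contraction_on (fun_scale scl) H ipH (mult_op \<Phi>) \<longleftrightarrow>
         pure_contraction_on scl E ipE (\<Phi> 0)"
proof -
  interpret H_m_space scl E ipE m H ipH
    using assms(3) unfolding is_H_m_def H_m_space_def .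
  show ?thesis
    by (rule pure_iff_pure_at_0[OF assms(4)])
qed

end
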